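(* Let $\mathcal{L}$ denote the operator of the transformed Sturm-Liouville problem, $$\mathcal{L} = \frac{1}{\rho(\phi(x))(\phi'(x))^{2}}\left(-\frac{d^{2}}{dx^{2}} + \tilde{q}(x)\right),$$ and let $\mathcal{J}$ be the parity operator, $\mathcal{J}f(x)=f(-x)$. If the commutator $[\mathcal{L},\mathcal{J}]=\mathcal{L}\mathcal{J}-\mathcal{J}\mathcal{L}$ is zero, i.e. $\mathcal{L}\mathcal{J}f=\mathcal{J}\mathcal{L}f$ for every twice continuously differentiable function $f$ on $\mathbb{R}$, then the $(2N+1)\times(2N+1)$ matrices $\mathbf{A}=(A_{j,k})_{-N\le j,k\le N}$ and $\mathbf{D}^{2}=(D^{2}_{j,k})_{-N\le j,k\le N}$ resulting from the double exponential Sinc collocation method, with entries $$A_{j,k} = -\frac{1}{h^{2}}\,\delta^{(2)}_{j,k} + \tilde{q}(kh)\,\delta^{(0)}_{j,k},\qquad D^{2}_{j,k} = (\phi'(kh))^{2}\rho(\phi(kh))\,\delta^{(0)}_{j,k},$$ are centrosymmetric.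
   Context: Setting. Let $-\infty\le a<b\le\infty$. The Sturm-Liouville problem is $-u''(x)+q(x)u(x)=\lambda\rho(x)u(x)$ for $a<x<b$, with $u(a)=u(b)=0$, where $q$ is non-negative and the weight $\rho$ is positive on $(a,b)$. The function $\phi$ maps $\mathbb{R}$ onto $(a,b)$, and its inverse $\phi^{-1}$ is a conformal map of a simply connected domain in the complex plane with boundary points $a\ne b$ such that $\phi^{-1}(a)=-\infty$ and $\phi^{-1}(b)=\infty$; in particular $\phi$ is smooth with $\phi'>0$ on $\mathbb{R}$. The substitution $u(x)=v(\phi^{-1}(x))/\sqrt{(\phi^{-1})'(x)}$ turns the problem into $$-v''(x)+\tilde{q}(x)v(x)=\lambda\rho(\phi(x))(\phi'(x))^{2}v(x),\qquad \lim_{|x|\to\infty}v(x)=0,$$ where $$\tilde{q}(x) = -\sqrt{\phi'(x)}\,\frac{d}{dx}\left(\frac{1}{\phi'(x)}\frac{d}{dx}\left(\sqrt{\phi'(x)}\right)\right)+(\phi'(x))^{2}q(\phi(x)).$$ In the double exponential Sinc collocation method, $\phi$ is chosen so that the solution satisfies $|v(x)|\le A\exp(-B\exp(\gamma|x|))$ for some positive constants $A,B,\gamma$. Sinc notation. $\mathrm{sinc}(z)=\sin(\pi z)/(\pi z)$ for $z\neq 0$ and $\mathrm{sinc}(0)=1$. For $j\in\mathbb{Z}$ and $h>0$, $S(j,h)(x)=\mathrm{sinc}\left(\frac{x-jh}{h}\right)$. The $l$-th Sinc differentiation matrix with unit mesh size has entries $$\delta^{(l)}_{j,k} = h^{l}\left.\left(\frac{d}{dx}\right)^{l}S(j,h)(x)\right|_{x=kh};$$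 in particular $\delta^{(0)}_{j,k}$ is the Kronecker delta. Here $N$ is a positive integer and $h>0$ is the mesh size. Centrosymmetry. A $(2N+1)\times(2N+1)$ matrix $\mathbf{B}$ with entries $B_{j,k}$, $-N\le j,k\le N$, is centrosymmetric if $\mathbf{B}\mathbf{J}=\mathbf{J}\mathbf{B}$, where $\mathbf{J}$ is the exchange matrix (ones on the anti-diagonal, zeros elsewhere); equivalently, $B_{-j,-k}=B_{j,k}$ for all $-N\le j,k\le N$. *)

theory Defs
  imports "HOL-Analysis.Analysis" "Jordan_Normal_Form.Matrix"
begin

definition twice_cont_differentiable :: "(real \<Rightarrow> real) \<Rightarrow> bool" where
  "twice_cont_differentiable f \<longleftrightarrow>
     (\<exists>f' f''. (\<forall>x. (f has_real_derivative f' x) (at x)) \<and>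
              (\<forall>x. (f' has_real_derivative f'' x) (at x)) \<and>
              continuous_on UNIV f'')"

definition q_tilde :: "(real \<Rightarrow> real) \<Rightarrow> (real \<Rightarrow> real) \<Rightarrow> real \<Rightarrow> real" where
  "q_tilde q \<phi> x =
     - sqrt (deriv \<phi> x) *
         deriv (\<lambda>y. 1 / deriv \<phi> y * deriv (\<lambda>t. sqrt (deriv \<phi> t)) y) x
     + (deriv \<phi> x)\<^sup>2 * q (\<phi> x)"

definition sl_operator ::
    "(real \<Rightarrow> real) \<Rightarrow> (real \<Rightarrow> real) \<Rightarrow> (real \<Rightarrow> real) \<Rightarrow> (real \<Rightarrow> real) \<Rightarrow> real \<Rightarrow> real" where
  "sl_operator q \<rho> \<phi> f x =
     1 / (\<rho> (\<phi> x) * (deriv \<phi> x)\<^sup>2) * (- deriv (deriv f) x + q_tilde q \<phi> x * f x)"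

definition transformed_solution ::
    "(real \<Rightarrow> real) \<Rightarrow> (real \<Rightarrow> real) \<Rightarrow> (real \<Rightarrow> real) \<Rightarrow> real \<Rightarrow> (real \<Rightarrow> real) \<Rightarrow> bool" where
  "transformed_solution q \<rho> \<phi> \<mu> v \<longleftrightarrow>
     twice_cont_differentiable v \<and>
     (\<forall>x. - deriv (deriv v) x + q_tilde q \<phi> x * v x
            = \<mu> * \<rho> (\<phi> x) * (deriv \<phi> x)\<^sup>2 * v x) \<and>
     (v \<longlongrightarrow> 0) at_infinity"

definition parity :: "(real \<Rightarrow> real) \<Rightarrow> real \<Rightarrow> real" where
  "parity f x = f (- x)"

definition commutator ::
    "((real \<Rightarrow> real) \<Rightarrow> real \<Rightarrow> real) \<Rightarrow> ((real \<Rightarrow> real) \<Rightarrow> real \<Rightarrow> real)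
      \<Rightarrow> (real \<Rightarrow> real) \<Rightarrow> real \<Rightarrow> real" where
  "commutator S T f x = S (T f) x - T (S f) x"

text \<open>
  The endpoints are extended reals. An infinite endpoint is a boundary point of a planar domain
  in the sense of the Riemann sphere, i.e. when the domain is unbounded.
\<close>

definition boundary_point :: "ereal \<Rightarrow> complex set \<Rightarrow> bool" where
  "boundary_point c D \<longleftrightarrow>
     (if \<bar>c\<bar> = \<infinity> then \<not> bounded D else complex_of_real (real_of_ereal c) \<in> frontier D)"

text \<open>
  The function \<open>\<psi>\<close> is the conformal map on the domain \<open>D\<close> which
  extends the real inverse of \<open>\<phi>\<close>.
  Smoothness of \<open>\<phi>\<close> and positivity of its derivative are consequences. The values of the
  inverse at the endpoints are one-sided limits.
\<close>

locale de_sinc_problem =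
  fixes a b :: ereal
    and q \<rho> \<phi> :: "real \<Rightarrow> real"
    and D :: "complex set"
    and \<psi> :: "complex \<Rightarrow> complex"
  assumes a_less_b: "a < b"
    and q_nonneg: "\<And>x. x \<in> einterval a b \<Longrightarrow> 0 \<le> q x"
    and rho_pos: "\<And>x. x \<in> einterval a b \<Longrightarrow> 0 < \<rho> x"
    and phi_bij: "bij_betw \<phi> UNIV (einterval a b)"
    and D_open: "open D"
    and D_simply_connected: "simply_connected D"
    and interval_in_D: "complex_of_real ` einterval a b \<subseteq> D"
    and boundary_a: "boundary_point a D"
    and boundary_b: "boundary_point b D"
    and psi_holomorphic: "\<psi> holomorphic_on D"
    and psi_inj: "inj_on \<psi> D"
    and psi_extends:
      "\<And>x. x \<in> einterval a b \<Longrightarrow> \<psi> (complex_of_real x) = complex_of_real (inv_into UNIV \<phi> x)"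
    and inv_phi_a: "filterlim (inv_into UNIV \<phi> \<circ> real_of_ereal) at_bot (at_right a)"
    and inv_phi_b: "filterlim (inv_into UNIV \<phi> \<circ> real_of_ereal) at_top (at_left b)"
    and double_exponential_decay:
      "\<And>\<mu> v. transformed_solution q \<rho> \<phi> \<mu> v \<Longrightarrow>
         \<exists>A>0. \<exists>B>0. \<exists>\<gamma>>0. \<forall>x. \<bar>v x\<bar> \<le> A * exp (- B * exp (\<gamma> * \<bar>x\<bar>))"

text \<open>Normalised by \<open>pi\<close>, unlike the \<open>sinc\<close> of \<open>HOL-Probability\<close>.\<close>

definition nsinc :: "real \<Rightarrow> real" where
  "nsinc z = (if z = 0 then 1 else sin (pi * z) / (pi * z))"

definition sinc_basis :: "int \<Rightarrow> real \<Rightarrow> real \<Rightarrow> real" where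
  "sinc_basis j h x = nsinc ((x - of_int j * h) / h)"

definition sinc_delta :: "nat \<Rightarrow> real \<Rightarrow> int \<Rightarrow> int \<Rightarrow> real" where
  "sinc_delta l h j k = h ^ l * (deriv ^^ l) (sinc_basis j h) (of_int k * h)"

text \<open>
  A matrix with entries \<open>B j k\<close> for \<open>j\<close> and \<open>k\<close> between \<open>-N\<close> and \<open>N\<close> is stored
  with row and column numbers from \<open>0\<close> to \<open>2N\<close>.
\<close>

definition centered_mat :: "nat \<Rightarrow> (int \<Rightarrow> int \<Rightarrow> real) \<Rightarrow> real mat" where
  "centered_mat N B =
     Matrix.mat (2 * N + 1) (2 * N + 1) (\<lambda>(r, c). B (int r - int N) (int c - int N))"

definition exchange_mat :: "nat \<Rightarrow> real mat" where
  "exchange_mat n = Matrix.mat n n (\<lambda>(r, c). if r + c + 1 = n then 1 else 0)"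

definition centrosymmetric :: "real mat \<Rightarrow> bool" where
  "centrosymmetric B \<longleftrightarrow>
     square_mat B \<and> B * exchange_mat (dim_row B) = exchange_mat (dim_row B) * B"

definition collocation_A ::
    "(real \<Rightarrow> real) \<Rightarrow> (real \<Rightarrow> real) \<Rightarrow> nat \<Rightarrow> real \<Rightarrow> real mat" where
  "collocation_A q \<phi> N h =
     centered_mat N (\<lambda>j k. - (1 / h\<^sup>2) * sinc_delta 2 h j k
                           + q_tilde q \<phi> (of_int k * h) * sinc_delta 0 h j k)"

definition collocation_D2 ::
    "(real \<Rightarrow> real) \<Rightarrow> (real \<Rightarrow> real) \<Rightarrow> nat \<Rightarrow> real \<Rightarrow> real mat" where
  "collocation_D2 \<rho> \<phi> N h =
     centered_mat N (\<lambda>j k. (deriv \<phi> (of_int k * h))\<^sup>2 * \<rho> (\<phi> (of_int k * h)) * sinc_delta 0 h j k)"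

end

theory Submission
  imports Defs "HOL-Real_Asymp.Real_Asymp"
begin

text \<open>
  If \<open>f\<close> is even, then commutation with the parity operator says that the image of \<open>f\<close> under
  the Sturm-Liouville operator is again even. Write \<open>w = \<rho>(\<phi>) \<phi>'\<^sup>2\<close> for the transformed
  weight. The even function \<open>1\<close> has image \<open>q_tilde / w\<close>, and \<open>x\<^sup>2\<close> has image
  \<open>(- 2 + x\<^sup>2 q_tilde) / w\<close>; since both are even, so is \<open>1 / w\<close>. Hence \<open>w\<close> is even, and so is
  \<open>q_tilde\<close>. This takes care of every entry in which a coefficient is sampled at the mesh points.

  The remaining factors are Sinc differentiation matrices. The normalised sinc function is even,
  so reflecting the centre of a Sinc basis function amounts to reflecting its argument.
  Differentiating twice produces two signs, which cancel, so the matrices of order \<open>0\<close> and \<open>2\<close>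
  are unchanged when both indices are negated. For a matrix indexed symmetrically about \<open>0\<close> that
  invariance of the entries is centrosymmetry, because the exchange matrix acts on either side by
  reversing an index.
\<close>

section \<open>Centrosymmetry in terms of entries\<close>

lemma index_mult_exchange_mat:
  assumes "B \<in> carrier_mat n n" "r < n" "c < n"
  shows "(B * exchange_mat n) $$ (r, c) = B $$ (r, n - 1 - c)"
    and "(exchange_mat n * B) $$ (r, c) = B $$ (n - 1 - r, c)"
proof -
  have "(B * exchange_mat n) $$ (r, c)
      = (\<Sum>i\<in>{0..<n}. B $$ (r, i) * (if i + c + 1 = n then 1 else 0))"
    using assms by (auto simp: exchange_mat_def scalar_prod_def intro!: sum.cong)
  also have "\<dots> = (\<Sum>i\<in>{0..<n}. if n - 1 - c = i then B $$ (r, i) else 0)"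
    using assms by (intro sum.cong) auto
  also have "\<dots> = B $$ (r, n - 1 - c)"
    using assms by (subst sum.delta') auto
  finally show "(B * exchange_mat n) $$ (r, c) = B $$ (r, n - 1 - c)" .
  have "(exchange_mat n * B) $$ (r, c)
      = (\<Sum>i\<in>{0..<n}. (if r + i + 1 = n then 1 else 0) * B $$ (i, c))"
    using assms by (auto simp: exchange_mat_def scalar_prod_def intro!: sum.cong)
  also have "\<dots> = (\<Sum>i\<in>{0..<n}. if n - 1 - r = i then B $$ (i, c) else 0)"
    using assms by (intro sum.cong) auto
  also have "\<dots> = B $$ (n - 1 - r, c)"
    using assms by (subst sum.delta') auto
  finally show "(exchange_mat n * B) $$ (r, c) = B $$ (n - 1 - r, c)" .
qed

lemma centrosymmetric_centered_matI:
  assumes "\<And>j k. B (- j) (- k) = B j k"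
  shows "centrosymmetric (centered_mat N B)"
proof -
  define n where "n = 2 * N + 1"
  have carrier: "centered_mat N B \<in> carrier_mat n n"
    by (simp add: centered_mat_def n_def)
  have entry: "centered_mat N B $$ (r, n - 1 - c) = centered_mat N B $$ (n - 1 - r, c)"
    if "r < n" "c < n" for r c
  proof -
    have reverse: "int (n - 1 - i) - int N = - (int i - int N)" if "i < n" for i
      using that by (simp add: n_def of_nat_diff)
    have "centered_mat N B $$ (r, n - 1 - c) = B (int r - int N) (int (n - 1 - c) - int N)"
      using that unfolding centered_mat_def n_def[symmetric] by simp
    also have "\<dots> = B (int (n - 1 - r) - int N) (int c - int N)"
      using assms[of "int r - int N" "- (int c - int N)"]
      by (simp only: reverse[OF that(1)] reverse[OF that(2)]) simp
    also have "\<dots> = centered_mat N B $$ (n - 1 - r, c)"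
      using that unfolding centered_mat_def n_def[symmetric] by simp
    finally show ?thesis .
  qed
  have "centered_mat N B * exchange_mat n = exchange_mat n * centered_mat N B"
  proof (rule eq_matI)
    fix r c
    assume "r < dim_row (exchange_mat n * centered_mat N B)"
      and "c < dim_col (exchange_mat n * centered_mat N B)"
    then have "r < n" "c < n"
      using carrier by (auto simp: exchange_mat_def)
    then show "(centered_mat N B * exchange_mat n) $$ (r, c)
        = (exchange_mat n * centered_mat N B) $$ (r, c)"
      by (simp only: index_mult_exchange_mat[OF carrier] entry)
  qed (use carrier in \<open>auto simp: exchange_mat_def\<close>)
  then show ?thesis
    using carrier by (auto simp: centrosymmetric_def)
qed

section \<open>Reflection of the Sinc differentiation matrices\<close>

text \<open>
  Differentiability of \<open>f\<close> makes the first derivative of the reflection the odd reflection of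
  \<open>deriv f\<close>. These two functions have the same difference quotients at mirrored points, so
  \<open>deriv\<close> takes the same value on both, even where a second derivative does not exist.
\<close>

lemma deriv_twice_reflect:
  fixes f :: "real \<Rightarrow> real"
  assumes "\<And>x. f differentiable (at x)"
  shows "(deriv ^^ 2) (\<lambda>x. f (- x)) x = (deriv ^^ 2) f (- x)"
proof -
  have first: "deriv (\<lambda>x. f (- x)) = (\<lambda>x. - deriv f (- x))"
  proof
    fix x
    have "(f has_real_derivative deriv f (- x)) (at (- x))"
      using assms by (simp add: DERIV_deriv_iff_real_differentiable)
    then show "deriv (\<lambda>x. f (- x)) x = - deriv f (- x)"
      by (intro DERIV_imp_deriv) (simp add: DERIV_mirror)
  qed
  have "((\<lambda>x. - deriv f (- x)) has_real_derivative c) (at x)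
      \<longleftrightarrow> (deriv f has_real_derivative c) (at (- x))" for c
    using DERIV_mirror[where f = "deriv f" and x = x and y = c]
      DERIV_minus[of "\<lambda>x. deriv f (- x)" "- c" x UNIV]
      DERIV_minus[of "\<lambda>x. - deriv f (- x)" c x UNIV]
    by auto
  then show ?thesis
    by (simp add: numeral_2_eq_2 first deriv_def)
qed

lemma nsinc_minus [simp]: "nsinc (- z) = nsinc z"
  by (simp add: nsinc_def)

lemma nsinc_differentiable: "nsinc differentiable (at z)"
proof (cases "z = 0")
  case True
  have "(\<lambda>y. (sin (pi * y) / (pi * y) - 1) / y) \<midarrow>0\<rightarrow> (0::real)"
    by real_asymp
  then have "(\<lambda>y. (nsinc (0 + y) - nsinc 0) / y) \<midarrow>0\<rightarrow> 0"
    by (rule Lim_transform_eventually) (auto simp: nsinc_def eventually_at_filter)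
  then show ?thesis
    using True DERIV_def real_differentiable_def by blast
next
  case False
  have "((\<lambda>z. sin (pi * z) / (pi * z)) has_real_derivative
      (cos (pi * z) * pi * (pi * z) - sin (pi * z) * pi) / ((pi * z) * (pi * z))) (at z)"
    using False by (auto intro!: derivative_eq_intros)
  moreover have "\<forall>\<^sub>F y in nhds z. y \<noteq> 0"
    using False by (rule t1_space_nhds)
  then have "\<forall>\<^sub>F y in nhds z. nsinc y = sin (pi * y) / (pi * y)"
    by eventually_elim (simp add: nsinc_def)
  then have "(nsinc has_real_derivative c) (at z)
      \<longleftrightarrow> ((\<lambda>z. sin (pi * z) / (pi * z)) has_real_derivative c) (at z)" for c
    by (intro DERIV_cong_ev) simp_all
  ultimately show ?thesis
    unfolding real_differentiable_def by blast
qed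

lemma sinc_basis_differentiable: "sinc_basis j h differentiable (at x)"
proof -
  have "(\<lambda>x. (x - of_int j * h) / h) differentiable (at x)"
    unfolding divide_inverse by (intro derivative_intros)
  then have "nsinc \<circ> (\<lambda>x. (x - of_int j * h) / h) differentiable (at x)"
    by (rule differentiable_chain_at) (rule nsinc_differentiable)
  then show ?thesis
    by (simp add: sinc_basis_def[abs_def] o_def)
qed

lemma sinc_basis_uminus: "sinc_basis (- j) h x = sinc_basis j h (- x)"
proof -
  have "(- x - of_int j * h) / h = - ((x - of_int (- j) * h) / h)"
    by (simp add: minus_divide_left)
  then show ?thesis
    by (simp only: sinc_basis_def nsinc_minus)
qed

lemma sinc_delta_0_uminus: "sinc_delta 0 h (- j) (- k) = sinc_delta 0 h j k"
  by (simp add: sinc_delta_def sinc_basis_uminus)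

lemma sinc_delta_2_uminus: "sinc_delta 2 h (- j) (- k) = sinc_delta 2 h j k"
proof -
  have "sinc_basis (- j) h = (\<lambda>x. sinc_basis j h (- x))"
    by (rule ext) (rule sinc_basis_uminus)
  then show ?thesis
    by (simp only: sinc_delta_def deriv_twice_reflect[OF sinc_basis_differentiable]) simp
qed

section \<open>Evenness of the coefficients\<close>

lemma sl_operator_even:
  assumes "commutator (sl_operator q \<rho> \<phi>) parity f = (\<lambda>x. 0)"
    and "\<And>x. f (- x) = f x"
  shows "sl_operator q \<rho> \<phi> f (- x) = sl_operator q \<rho> \<phi> f x"
proof -
  have "parity f = f"
    by (rule ext) (simp add: parity_def assms(2))
  then show ?thesis
    using fun_cong[OF assms(1), of x] by (simp add: commutator_def parity_def)
qed

text \<open>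
  The test functions \<open>1\<close> and \<open>x\<^sup>2\<close> separate the two coefficients: both are even, and their
  second derivatives are different constants. Since \<open>1 / 0 = 0\<close>, the
  reciprocal determines the weight even at its zeros.
\<close>

lemma coefficients_even:
  assumes "\<And>f. twice_cont_differentiable f \<Longrightarrow>
      commutator (sl_operator q \<rho> \<phi>) parity f = (\<lambda>x. 0)"
  defines "w \<equiv> \<lambda>x. \<rho> (\<phi> x) * (deriv \<phi> x)\<^sup>2"
  shows weight_even: "w (- x) = w x"
    and potential_quotient_even: "q_tilde q \<phi> (- x) / w (- x) = q_tilde q \<phi> x / w x"
proof -
  have const: "twice_cont_differentiable (\<lambda>x. 1)"
    unfolding twice_cont_differentiable_def
    by (intro exI[of _ "\<lambda>x. 0"]) (auto intro!: derivative_eq_intros)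
  have square: "twice_cont_differentiable (\<lambda>x. x\<^sup>2)"
    unfolding twice_cont_differentiable_def
    by (intro exI[of _ "\<lambda>x. 2 * x"] exI[of _ "\<lambda>x. 2"]) (auto intro!: derivative_eq_intros)
  have "deriv (\<lambda>x::real. x\<^sup>2) = (\<lambda>x. 2 * x)"
    by (rule ext, rule DERIV_imp_deriv) (auto intro!: derivative_eq_intros)
  moreover have "deriv (\<lambda>x::real. 2 * x) = (\<lambda>x. 2)"
    by (rule ext, rule DERIV_imp_deriv) (auto intro!: derivative_eq_intros)
  ultimately have image_square:
    "sl_operator q \<rho> \<phi> (\<lambda>x. x\<^sup>2) x = - 2 * (1 / w x) + x\<^sup>2 * (q_tilde q \<phi> x / w x)" for x
    by (simp add: sl_operator_def w_def diff_divide_distrib add_divide_distrib)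
  have image_const: "sl_operator q \<rho> \<phi> (\<lambda>x. 1) x = q_tilde q \<phi> x / w x" for x
    by (simp add: sl_operator_def w_def)
  show quotient: "q_tilde q \<phi> (- x) / w (- x) = q_tilde q \<phi> x / w x"
    using sl_operator_even[OF assms(1)[OF const], of x] by (simp only: image_const)
  have "sl_operator q \<rho> \<phi> (\<lambda>x. x\<^sup>2) (- x) = sl_operator q \<rho> \<phi> (\<lambda>x. x\<^sup>2) x"
    by (rule sl_operator_even[OF assms(1)[OF square]]) simp
  then have "1 / w (- x) = 1 / w x"
    by (simp only: image_square quotient) simp
  then show "w (- x) = w x"
    by simp
qed

text \<open>
  Where \<open>\<phi>'\<close> is not zero, the weight is not zero and can be cancelled from the even quotient of
  potential and weight. At a zero of \<open>\<phi>'\<close> both terms of the transformed potential vanish,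
  and evenness of the weight makes the mirrored point a zero as well.
\<close>

lemma q_tilde_even:
  assumes "\<And>f. twice_cont_differentiable f \<Longrightarrow>
      commutator (sl_operator q \<rho> \<phi>) parity f = (\<lambda>x. 0)"
    and "\<And>x. 0 < \<rho> (\<phi> x)"
  shows "q_tilde q \<phi> (- x) = q_tilde q \<phi> x"
proof (cases "deriv \<phi> x = 0")
  case True
  have "\<rho> (\<phi> (- x)) * (deriv \<phi> (- x))\<^sup>2 = 0"
    using weight_even[OF assms(1), of x] True by simp
  with assms(2)[of "- x"] have "deriv \<phi> (- x) = 0"
    by simp
  with True show ?thesis
    by (simp add: q_tilde_def)
next
  case False
  with assms(2)[of x] have "\<rho> (\<phi> x) * (deriv \<phi> x)\<^sup>2 \<noteq> 0"
    by simp
  with potential_quotient_even[OF assms(1), of x] show ?thesis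
    by (simp only: weight_even[OF assms(1)] divide_cancel_right) simp
qed

section \<open>Centrosymmetry of the collocation matrices\<close>

theorem theorem3p5:
  fixes a b :: ereal
    and q \<rho> \<phi> :: "real \<Rightarrow> real"
    and D :: "complex set"
    and \<psi> :: "complex \<Rightarrow> complex"
    and N :: nat
    and h :: real
  assumes "de_sinc_problem a b q \<rho> \<phi> D \<psi>"
    and "N \<ge> 1"
    and "h > 0"
    and "\<And>f. twice_cont_differentiable f \<Longrightarrow>
           commutator (sl_operator q \<rho> \<phi>) parity f = (\<lambda>x. 0)"
  shows "centrosymmetric (collocation_A q \<phi> N h) \<and> centrosymmetric (collocation_D2 \<rho> \<phi> N h)"
proof
  interpret de_sinc_problem a b q \<rho> \<phi> D \<psi>
    by (rule assms(1))
  have "\<phi> x \<in> einterval a b" for x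
    using bij_betwE[OF phi_bij] by blast
  then have rho_phi_pos: "0 < \<rho> (\<phi> x)" for x
    by (rule rho_pos)
  have "q_tilde q \<phi> (of_int (- k) * h) = q_tilde q \<phi> (of_int k * h)" for k
    using q_tilde_even[OF assms(4) rho_phi_pos, of "of_int k * h"] by simp
  then show "centrosymmetric (collocation_A q \<phi> N h)"
    unfolding collocation_A_def
    by (intro centrosymmetric_centered_matI)
      (simp only: sinc_delta_0_uminus sinc_delta_2_uminus)
  have "(deriv \<phi> (of_int (- k) * h))\<^sup>2 * \<rho> (\<phi> (of_int (- k) * h))
      = (deriv \<phi> (of_int k * h))\<^sup>2 * \<rho> (\<phi> (of_int k * h))" for k
    using weight_even[OF assms(4), of "of_int k * h"] by (simp add: mult.commute)
  then show "centrosymmetric (collocation_D2 \<rho> \<phi> N h)"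
    unfolding collocation_D2_def
    by (intro centrosymmetric_centered_matI) (simp only: sinc_delta_0_uminus)
qed

end
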